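(* Let $d\ge 1$ and $p\ge 1$ be integers. For the $d$-dimensional orthonormal Legendre polynomials of total order at most $p$ under standard sampling (i.e. $\bm{\Xi}$ is uniformly distributed on $[-1,1]^d$ and $w\equiv 1$), the coherence parameter satisfies $$\mu(\bm{\Xi})\le \exp(2p).$$
   Context: For a multi-index $\bm{k}=(k_1,\dots,k_d)$ of nonnegative integers set $\psi_{\bm{k}}(\bm{\xi})=\prod_{i=1}^d\psi_{k_i}(\xi_i)$, where $\psi_j$ is the univariate Legendre polynomial of degree $j$ normalized to be orthonormal with respect to the uniform probability density $1/2$ on $[-1,1]$. The polynomials of total order at most $p$ are those with $\|\bm{k}\|_1\le p$; there are $P=\binom{p+d}{d}$ of them, indexed also as $\psi_1,\dots,\psi_P$. For a random vector $\bm{Y}$ with weight function $w$, the coherence parameter is $$\mu(\bm{Y}):=\sup_{k=1,\dots,P,\ \bm{\xi}\in[-1,1]^d}|w(\bm{\xi})\psi_k(\bm{\xi})|^2.$$ Under standard sampling $\bm{Y}=\bm{\Xi}$ and $w\equiv1$. *)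

theory Defs
  imports "HOL-Probability.Probability" "HOL-Computational_Algebra.Polynomial"
begin

text \<open>
  Legendre polynomials \<open>P\<^sub>n\<close> in their classical scaling, by Rodrigues' formula
  \<open>P\<^sub>n(x) = 1 / (2^n n!) * (d/dx)^n (x^2 - 1)^n\<close>.
\<close>

definition legendre_poly :: "nat \<Rightarrow> real poly" where
  "legendre_poly n = smult (1 / (2 ^ n * fact n)) ((pderiv ^^ n) ([:- 1, 0, 1:] ^ n))"

abbreviation unif_interval :: "real measure" where
  "unif_interval \<equiv> uniform_measure lborel {-1..1}"

definition legendre :: "nat \<Rightarrow> real poly" where
  "legendre n = smult (1 / sqrt (\<integral>x. (poly (legendre_poly n) x)\<^sup>2 \<partial>unif_interval)) (legendre_poly n)"

definition multi_legendre :: "nat ^ 'd \<Rightarrow> real ^ 'd \<Rightarrow> real" where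
  "multi_legendre k \<xi> = (\<Prod>i\<in>UNIV. poly (legendre (k $ i)) (\<xi> $ i))"

definition total_order :: "nat \<Rightarrow> (nat ^ 'd) set" where
  "total_order p = {k. (\<Sum>i\<in>UNIV. k $ i) \<le> p}"

abbreviation sym_cube :: "(real ^ 'd) set" where
  "sym_cube \<equiv> {\<xi>. \<forall>i. \<xi> $ i \<in> {-1..1}}"

text \<open>
  The coherence parameter of a random vector \<open>Y\<close> with weight function \<open>w\<close> depends on \<open>Y\<close> only
  through \<open>w\<close>. It is extended-real-valued, so that the supremum exists for every \<open>w\<close>.
\<close>

definition coherence :: "nat \<Rightarrow> (real ^ 'd \<Rightarrow> real) \<Rightarrow> ereal" where
  "coherence p w =
     (SUP (k, \<xi>) \<in> total_order p \<times> sym_cube. ereal (\<bar>w \<xi> * multi_legendre k \<xi>\<bar>\<^sup>2))"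

definition standard_sampling ::
    "'a measure \<Rightarrow> ('a \<Rightarrow> real ^ 'd) \<Rightarrow> (real ^ 'd \<Rightarrow> real) \<Rightarrow> bool" where
  "standard_sampling M \<Xi> w \<longleftrightarrow>
     prob_space M \<and> \<Xi> \<in> borel_measurable M \<and>
     distr M lborel \<Xi> = uniform_measure lborel sym_cube \<and>
     (\<forall>\<xi>\<in>sym_cube. w \<xi> = 1)"


subsection \<open>Degree and orthonormality of the normalized Legendre polynomials\<close>

lemma integral_unif_interval:
  assumes "continuous_on UNIV (f :: real \<Rightarrow> real)"
  shows "(\<integral>x. f x \<partial>unif_interval) = (1/2) * (\<integral>x. indicator {-1..1} x *\<^sub>R f x \<partial>lborel)"
proof -
  have *: "(\<lambda>x::real. indicator {-1..1} x / emeasure lborel {-1..1::real})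
        = (\<lambda>x. ennreal (indicator {-1..1} x / 2))"
  proof (rule ext)
    fix x :: real
    have "(1 :: ennreal) / 2 = ennreal (1 / 2)"
      using divide_ennreal[of 1 2] by simp
    then show "indicator {-1..1} x / emeasure lborel {-1..1::real} = ennreal (indicator {-1..1} x / 2)"
      by (simp add: indicator_def)
  qed
  have "f \<in> borel_measurable lborel"
    using assms by (simp add: borel_measurable_continuous_onI)
  then have "(\<integral>x. f x \<partial>unif_interval) = (\<integral>x. (indicator {-1..1} x / 2) *\<^sub>R f x \<partial>lborel)"
    unfolding uniform_measure_def * by (intro integral_density) auto
  also have "\<dots> = (\<integral>x. (1/2) * (indicator {-1..1} x *\<^sub>R f x) \<partial>lborel)"
    by (simp add: field_simps)
  finally show ?thesis by simp
qed

lemma integral_unif_interval_pderiv: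
  "(\<integral>x. poly (pderiv R) x \<partial>unif_interval) = (poly R 1 - poly R (-1)) / 2"
proof -
  have "(\<integral>x. indicator {-1..1} x *\<^sub>R poly (pderiv R) x \<partial>lborel) = poly R 1 - poly R (-1)"
  proof (intro integral_FTC_atLeastAtMost)
    fix x :: real
    show "(poly R has_vector_derivative poly (pderiv R) x) (at x within {-1..1})"
      using poly_DERIV[of R x] has_field_derivative_at_within
        has_real_derivative_iff_has_vector_derivative by blast
  qed (auto intro!: continuous_intros)
  then show ?thesis
    by (subst integral_unif_interval) (auto intro!: continuous_intros)
qed

lemma higher_pderiv_power_dvd:
  fixes u :: "real poly"
  assumes "j \<le> n"
  shows "u ^ (n - j) dvd (pderiv ^^ j) (u ^ n)"
  using assms
proof (induction j)
  case (Suc j)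
  then obtain v where v: "(pderiv ^^ j) (u ^ n) = u ^ (n - j) * v"
    by (auto elim: dvdE)
  have "n - j = Suc (n - Suc j)" using Suc.prems by simp
  then have "(pderiv ^^ Suc j) (u ^ n) = pderiv (u ^ Suc (n - Suc j) * v)"
    using v by simp
  also have "u ^ (n - Suc j) dvd \<dots>"
    unfolding pderiv_mult pderiv_power_Suc by (auto intro!: dvd_add dvd_smult)
  finally show ?case .
qed simp

lemma higher_pderiv_antiderivative:
  fixes u q :: "real poly"
  assumes "poly u 1 = 0" "poly u (-1) = 0" "j \<le> n" "degree q < j"
  shows "\<exists>R. pderiv R = q * (pderiv ^^ j) (u ^ n) \<and> poly R 1 = 0 \<and> poly R (-1) = 0"
  using assms(3,4)
proof (induction j arbitrary: q)
  case (Suc j)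
  let ?D = "(pderiv ^^ j) (u ^ n)"
  have D: "u dvd ?D"
    using higher_pderiv_power_dvd[of j n u] Suc.prems(1)
    by (metis Suc_le_lessD dvd_power dvd_trans less_imp_le zero_less_diff)
  have D0: "poly ?D 1 = 0" "poly ?D (-1) = 0"
    using D assms(1,2) by (auto elim!: dvdE)
  obtain S where S: "pderiv S = pderiv q * ?D" "poly S 1 = 0" "poly S (-1) = 0"
  proof (cases "degree q = 0")
    case True
    then have "pderiv q = 0" by (simp add: pderiv_eq_0_iff)
    then show ?thesis by (intro that[of 0]) auto
  next
    case False
    then have "degree (pderiv q) < j" using Suc.prems(2) by (simp add: degree_pderiv)
    then show ?thesis using Suc.IH[of "pderiv q"] Suc.prems(1) that by auto
  qed
  show ?case
    using S D0 by (intro exI[of _ "q * ?D - S"]) (auto simp: pderiv_diff pderiv_mult mult.commute)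
qed simp

lemma degree_legendre_poly: "degree (legendre_poly n) = n"
proof -
  have "degree ([:- 1, 0, 1 :: real:] ^ n) = 2 * n"
    by (simp add: degree_power_eq)
  then show ?thesis by (simp add: legendre_poly_def degree_higher_pderiv)
qed

lemma legendre_poly_nz: "legendre_poly n \<noteq> 0"
proof (cases "n = 0")
  case True
  then show ?thesis by (simp add: legendre_poly_def)
next
  case False
  then show ?thesis using degree_legendre_poly[of n] by auto
qed

lemma legendre_poly_orthogonal:
  assumes "m < n"
  shows "(\<integral>x. poly (legendre_poly m) x * poly (legendre_poly n) x \<partial>unif_interval) = 0"
proof -
  let ?c = "1 / (2 ^ n * fact n) :: real"
  obtain R where R: "pderiv R = smult ?c (legendre_poly m) * (pderiv ^^ n) ([:- 1, 0, 1:] ^ n)"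
      "poly R 1 = 0" "poly R (-1) = 0"
    using higher_pderiv_antiderivative[of "[:- 1, 0, 1:]" n n "smult ?c (legendre_poly m)"]
      assms by (auto simp: degree_legendre_poly)
  have "pderiv R = legendre_poly m * legendre_poly n"
    unfolding R(1) by (simp add: legendre_poly_def[of n])
  then show ?thesis
    using integral_unif_interval_pderiv[of R] R(2,3) by simp
qed

lemma legendre_poly_norm_pos:
  "(\<integral>x. (poly (legendre_poly n) x)\<^sup>2 \<partial>unif_interval) > 0"
proof -
  let ?f = "\<lambda>x. (poly (legendre_poly n) x)\<^sup>2"
  let ?g = "\<lambda>x. indicator {-1..1} x *\<^sub>R ?f x"
  have "continuous_on {-1..1} ?f"
    by (intro continuous_intros)
  then have int: "integrable lborel ?g"
    using borel_integrable_compact[of "{-1..1::real}" ?f] by simp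
  have "\<not> (AE x in lborel. ?g x = 0)"
  proof
    assume "AE x in lborel. ?g x = 0"
    moreover have "AE x in lborel. x \<notin> {x. poly (legendre_poly n) x = 0}"
      using poly_roots_finite[OF legendre_poly_nz[of n]]
      by (intro AE_not_in finite_imp_null_set_lborel)
    ultimately have "AE x in lborel. x \<notin> {-1..1::real}"
      by eventually_elim (auto simp: indicator_def split: if_splits)
    then have "emeasure lborel {-1..1::real} = 0"
      by (subst (asm) AE_iff_measurable[where N = "{-1..1}"]) auto
    then show False by simp
  qed
  then have "integral\<^sup>L lborel ?g \<noteq> 0"
    using integral_nonneg_eq_0_iff_AE[OF int] by simp
  moreover have "integral\<^sup>L lborel ?g \<ge> 0"
    by (rule integral_nonneg_AE) simp
  ultimately have "integral\<^sup>L lborel ?g > 0"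
    by linarith
  then show ?thesis
    by (subst integral_unif_interval) (auto intro!: continuous_intros)
qed

lemma degree_legendre: "degree (legendre n) = n"
  using legendre_poly_norm_pos[of n] by (simp add: legendre_def degree_legendre_poly)

lemma legendre_orthonormal:
  "(\<integral>x. poly (legendre m) x * poly (legendre n) x \<partial>unif_interval) = (if m = n then 1 else 0)"
proof -
  define c where "c n = (\<integral>x. (poly (legendre_poly n) x)\<^sup>2 \<partial>unif_interval)" for n
  have c: "c n > 0" for n
    unfolding c_def by (rule legendre_poly_norm_pos)
  have "(\<integral>x. poly (legendre m) x * poly (legendre n) x \<partial>unif_interval)
      = (\<integral>x. (1 / (sqrt (c m) * sqrt (c n))) *
            (poly (legendre_poly m) x * poly (legendre_poly n) x) \<partial>unif_interval)"
    by (simp add: legendre_def c_def)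
  also have "\<dots> = (\<integral>x. poly (legendre_poly m) x * poly (legendre_poly n) x \<partial>unif_interval)
      / (sqrt (c m) * sqrt (c n))"
    by (subst integral_mult_right_zero) simp
  also have "\<dots> = (if m = n then 1 else 0)"
  proof (cases "m = n")
    case True
    then show ?thesis using c[of n] by (simp add: c_def power2_eq_square)
  next
    case False
    then have "m < n \<or> n < m" by arith
    then show ?thesis
      using legendre_poly_orthogonal[of m n] legendre_poly_orthogonal[of n m] False
      by (auto simp: mult.commute)
  qed
  finally show ?thesis .
qed

end

theory Submission
  imports Defs
begin

text \<open>
  A multivariate Legendre polynomial is a product of univariate ones, so the theorem rests on the
  sharp pointwise bound \<open>\<psi>\<^sub>n(x)\<^sup>2 \<le> 2n + 1\<close> on \<open>[-1, 1]\<close> for the orthonormal Legendre polynomial of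
  degree \<open>n\<close> (lemma \<open>legendre_sq_le\<close>). Since \<open>2n + 1 \<le> exp (2n)\<close>, the square of a product over a
  multi-index \<open>k\<close> is at most \<open>exp (2 \<Sum>\<^sub>i k\<^sub>i)\<close>, which is at most \<open>exp (2p)\<close> at total order \<open>p\<close>.

  Let \<open>P\<close> be the Legendre polynomial of degree \<open>n\<close> in its classical scaling, so that
  \<open>\<psi>\<^sub>n\<^sup>2 = P\<^sup>2 / \<integral> P\<^sup>2\<close>. The bound on this quotient has two halves.

  First, \<open>\<bar>P\<bar>\<close> is largest at an endpoint of the interval (lemma \<open>legendre_poly_sq_le_endpoint\<close>).
  Legendre's differential equation makes \<open>F = n(n + 1) P\<^sup>2 + (1 - x\<^sup>2) P'\<^sup>2\<close> have the derivative
  \<open>2 x P'\<^sup>2\<close>, so that \<open>F\<close> grows away from the origin, and at \<open>x = \<plusminus>1\<close> the second term of \<open>F\<close> vanishes.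

  Second, the endpoint values satisfy \<open>P(1)\<^sup>2 = P(-1)\<^sup>2 = (2n + 1) \<integral> P\<^sup>2\<close> for the uniform probability
  measure on \<open>[-1, 1]\<close> (lemmas \<open>legendre_poly_sq_minus_one\<close> and \<open>legendre_poly_sq_one\<close>). Both
  equations follow from the orthogonality of \<open>P\<close> to all polynomials of lower degree: it gives
  \<open>\<integral> P P' = 0\<close> and, as \<open>x P' - n P\<close> has degree less than \<open>n\<close>, also \<open>\<integral> x P P' = n \<integral> P\<^sup>2\<close>. The
  values at the endpoints arise when \<open>(P\<^sup>2)'\<close> and \<open>(x P\<^sup>2)'\<close> are integrated.
\<close>

text \<open>
  For \<open>u = (x\<^sup>2 - 1)\<^sup>n\<close> we have \<open>(x\<^sup>2 - 1) u' = 2 n x u\<close>. Differentiating this relation \<open>k + 1\<close> times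
  gives a second-order equation for the \<open>k\<close>-th derivative of \<open>u\<close>; the case \<open>k = n\<close> is Legendre's
  equation.
\<close>

lemma higher_pderiv_rodrigues_power_ode:
  fixes n k :: nat
  defines "U \<equiv> \<lambda>j. (pderiv ^^ j) ([:- 1, 0, 1 :: real:] ^ n)"
  shows "[:- 1, 0, 1:] * U (k + 2) + smult (2 * (real k + 1 - real n)) ([:0, 1:] * U (k + 1))
           + smult ((real k + 1) * (real k - 2 * real n)) (U k) = 0"
proof (induction k)
  case 0
  let ?q = "[:- 1, 0, 1 :: real:]"
  have q': "pderiv ?q = smult 2 [:0, 1:]"
    by (simp add: pderiv_pCons)
  have rel: "?q * pderiv (?q ^ n) = smult (2 * real n) ([:0, 1:] * ?q ^ n)"
  proof (cases n)
    case (Suc m)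
    then show ?thesis
      by (simp only: pderiv_power_Suc q') (simp add: algebra_simps)
  qed simp
  have "pderiv (?q * pderiv (?q ^ n) - smult (2 * real n) ([:0, 1:] * ?q ^ n)) = 0"
    by (simp only: rel diff_self pderiv_0)
  then show ?case
    unfolding pderiv_diff pderiv_mult pderiv_smult q'
    by (simp add: U_def poly_eq_poly_eq_iff [symmetric] fun_eq_iff pderiv_pCons
        numeral_2_eq_2 algebra_simps)
next
  case (Suc k)
  have U: "pderiv (U j) = U (Suc j)" for j
    by (simp add: U_def)
  have "pderiv ([:- 1, 0, 1:] * U (k + 2)
      + smult (2 * (real k + 1 - real n)) ([:0, 1:] * U (k + 1))
      + smult ((real k + 1) * (real k - 2 * real n)) (U k)) = 0"
    using Suc by simp
  then show ?case
    unfolding pderiv_add pderiv_mult pderiv_smult U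
    by (simp add: poly_eq_poly_eq_iff [symmetric] fun_eq_iff pderiv_pCons algebra_simps)
qed

lemma legendre_poly_ode:
  "(1 - x\<^sup>2) * poly (pderiv (pderiv (legendre_poly n))) x - 2 * x * poly (pderiv (legendre_poly n)) x
     + real n * (real n + 1) * poly (legendre_poly n) x = 0"
proof -
  let ?c = "1 / (2 ^ n * fact n) :: real"
  let ?U = "\<lambda>j. poly ((pderiv ^^ j) ([:- 1, 0, 1 :: real:] ^ n)) x"
  have "poly ([:- 1, 0, 1:] * (pderiv ^^ (n + 2)) ([:- 1, 0, 1 :: real:] ^ n)
      + smult (2 * (real n + 1 - real n)) ([:0, 1:] * (pderiv ^^ (n + 1)) ([:- 1, 0, 1:] ^ n))
      + smult ((real n + 1) * (real n - 2 * real n)) ((pderiv ^^ n) ([:- 1, 0, 1:] ^ n))) x = 0"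
    unfolding higher_pderiv_rodrigues_power_ode by simp
  then have *: "(1 - x\<^sup>2) * ?U (n + 2) - 2 * x * ?U (n + 1) + real n * (real n + 1) * ?U n = 0"
    by (simp add: algebra_simps power2_eq_square)
  have "(1 - x\<^sup>2) * (?c * ?U (n + 2)) - 2 * x * (?c * ?U (n + 1))
      + real n * (real n + 1) * (?c * ?U n)
      = ?c * ((1 - x\<^sup>2) * ?U (n + 2) - 2 * x * ?U (n + 1) + real n * (real n + 1) * ?U n)"
    by (simp only: algebra_simps)
  also have "\<dots> = 0"
    using * by simp
  finally show ?thesis
    by (simp add: legendre_poly_def pderiv_smult)
qed

text \<open>
  The function \<open>F = n(n + 1) P\<^sup>2 + (1 - x\<^sup>2) P'\<^sup>2\<close> dominates \<open>n(n + 1) P\<^sup>2\<close> on the interval, agrees with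
  it at \<open>\<plusminus>1\<close>, and is monotone on each side of the origin.
\<close>

lemma legendre_poly_sq_le_endpoint:
  assumes "x \<in> {-1..1}" "n > 0"
  shows "(poly (legendre_poly n) x)\<^sup>2
    \<le> max ((poly (legendre_poly n) 1)\<^sup>2) ((poly (legendre_poly n) (-1))\<^sup>2)"
proof -
  let ?P = "legendre_poly n"
  define c where "c = real n * (real n + 1)"
  define F where "F t = c * (poly ?P t)\<^sup>2 + (1 - t\<^sup>2) * (poly (pderiv ?P) t)\<^sup>2" for t
  have c: "c > 0" using assms(2) by (simp add: c_def)
  have F': "(F has_real_derivative 2 * t * (poly (pderiv ?P) t)\<^sup>2) (at t)" for t
  proof -
    let ?D = "poly (pderiv ?P) t" and ?DD = "poly (pderiv (pderiv ?P)) t"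
    have "(F has_real_derivative
        c * (2 * poly ?P t * ?D) + ((1 - t\<^sup>2) * (2 * ?D * ?DD) - 2 * t * ?D\<^sup>2)) (at t)"
      unfolding F_def by (auto intro!: derivative_eq_intros poly_DERIV)
    \<comment> \<open>The factor after \<open>2 * ?D\<close> is the left-hand side of Legendre's equation.\<close>
    also have "c * (2 * poly ?P t * ?D) + ((1 - t\<^sup>2) * (2 * ?D * ?DD) - 2 * t * ?D\<^sup>2)
        = 2 * ?D * ((1 - t\<^sup>2) * ?DD - 2 * t * ?D + c * poly ?P t) + 2 * t * ?D\<^sup>2"
      by (simp add: algebra_simps power2_eq_square)
    also have "\<dots> = 2 * t * ?D\<^sup>2"
      using legendre_poly_ode[of t n] by (simp add: c_def)
    finally show ?thesis .
  qed
  have "F x \<le> max (F 1) (F (-1))"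
  proof (cases "x \<ge> 0")
    case True
    have "F x \<le> F 1"
      by (rule DERIV_nonneg_imp_nondecreasing) (use assms True F' in \<open>auto intro!: exI\<close>)
    then show ?thesis by simp
  next
    case False
    have "F x \<le> F (-1)"
    proof (rule DERIV_nonpos_imp_nonincreasing [where f = F])
      fix t :: real assume "-1 \<le> t" "t \<le> x"
      then have "2 * t * (poly (pderiv ?P) t)\<^sup>2 \<le> 0"
        using False by (simp add: mult_le_0_iff)
      then show "\<exists>y. (F has_real_derivative y) (at t) \<and> y \<le> 0"
        using F' by blast
    qed (use assms in auto)
    then show ?thesis by simp
  qed
  moreover have "x\<^sup>2 \<le> 1"
    using assms(1) by (simp add: abs_square_le_1 abs_le_iff)
  then have "c * (poly ?P x)\<^sup>2 \<le> F x"
    by (simp add: F_def)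
  moreover have "max (F 1) (F (-1)) = c * max ((poly ?P 1)\<^sup>2) ((poly ?P (-1))\<^sup>2)"
    using c by (simp add: F_def max_def)
  ultimately have "c * (poly ?P x)\<^sup>2 \<le> c * max ((poly ?P 1)\<^sup>2) ((poly ?P (-1))\<^sup>2)"
    by linarith
  then show ?thesis using c by simp
qed

text \<open>
  Orthogonality to lower degrees, as the existence of an antiderivative that vanishes at both
  endpoints. In this form it combines with other antiderivatives by polynomial algebra alone.
\<close>

lemma legendre_poly_mult_antiderivative:
  assumes "degree q < n"
  obtains S where "pderiv S = q * legendre_poly n" "poly S 1 = 0" "poly S (-1) = 0"
proof -
  let ?c = "1 / (2 ^ n * fact n) :: real"
  obtain S where S: "pderiv S = smult ?c q * (pderiv ^^ n) ([:- 1, 0, 1:] ^ n)"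
      "poly S 1 = 0" "poly S (-1) = 0"
    using higher_pderiv_antiderivative[of "[:- 1, 0, 1:]" n n "smult ?c q"] assms by auto
  then have "pderiv S = q * legendre_poly n"
    by (simp add: legendre_poly_def)
  with S that show ?thesis by blast
qed

text \<open>
  The derivative of \<open>P\<^sup>2\<close> is \<open>2 P' P\<close>, whose integral vanishes because \<open>P'\<close> has lower degree than \<open>P\<close>.
\<close>

lemma legendre_poly_sq_minus_one:
  "(poly (legendre_poly n) (-1))\<^sup>2 = (poly (legendre_poly n) 1)\<^sup>2"
proof (cases "n = 0")
  case True
  then show ?thesis by (simp add: legendre_poly_def)
next
  case False
  let ?P = "legendre_poly n"
  have "degree (pderiv ?P) < n"
    using False by (simp add: degree_pderiv degree_legendre_poly)
  then obtain S where S: "pderiv S = pderiv ?P * ?P" "poly S 1 = 0" "poly S (-1) = 0"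
    by (rule legendre_poly_mult_antiderivative)
  have "pderiv (?P * ?P - smult 2 S) = 0"
    unfolding pderiv_diff pderiv_mult pderiv_smult S(1)
    by (simp add: poly_eq_poly_eq_iff [symmetric] fun_eq_iff algebra_simps)
  then show ?thesis
    using integral_unif_interval_pderiv[of "?P * ?P - smult 2 S"] S(2,3)
    by (simp add: power2_eq_square)
qed

text \<open>
  We have \<open>(x P\<^sup>2)' = (2n + 1) P\<^sup>2 + 2 (x P' - n P) P\<close>. The leading terms of \<open>x P'\<close> and \<open>n P\<close> cancel, so
  the last summand integrates to zero by orthogonality.
\<close>

lemma legendre_poly_sq_one:
  "(poly (legendre_poly n) 1)\<^sup>2
     = (2 * real n + 1) * (\<integral>x. (poly (legendre_poly n) x)\<^sup>2 \<partial>unif_interval)"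
proof -
  let ?P = "legendre_poly n"
  obtain S where S: "pderiv S = ([:0, 1:] * pderiv ?P - smult (real n) ?P) * ?P"
      "poly S 1 = 0" "poly S (-1) = 0"
  proof (cases n)
    case 0
    then show ?thesis
      by (intro that[of 0]) (simp_all add: legendre_poly_def pderiv_pCons)
  next
    case (Suc m)
    let ?q = "[:0, 1:] * pderiv ?P - smult (real n) ?P"
    have "coeff ?q i = 0" if "i \<ge> n" for i
    proof (cases "i = n")
      case True
      then show ?thesis by (simp add: Suc coeff_pderiv)
    next
      case False
      then show ?thesis
        using that by (cases i) (simp_all add: coeff_pderiv coeff_eq_0 degree_legendre_poly)
    qed
    then have "degree ?q \<le> m"
      by (intro degree_le) (simp add: Suc)
    then show ?thesis
      using that legendre_poly_mult_antiderivative[of ?q n] Suc by auto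
  qed
  have "pderiv ([:0, 1:] * (?P * ?P) - smult 2 S) = smult (2 * real n + 1) (?P * ?P)"
    unfolding pderiv_diff pderiv_mult pderiv_smult S(1)
    by (simp add: poly_eq_poly_eq_iff [symmetric] fun_eq_iff pderiv_pCons algebra_simps)
  then have "(\<integral>x. (2 * real n + 1) * (poly ?P x)\<^sup>2 \<partial>unif_interval)
      = ((poly ?P 1)\<^sup>2 + (poly ?P (-1))\<^sup>2) / 2"
    using integral_unif_interval_pderiv[of "[:0, 1:] * (?P * ?P) - smult 2 S"] S(2,3)
    by (simp add: power2_eq_square)
  then show ?thesis
    unfolding legendre_poly_sq_minus_one by simp
qed

lemma legendre_sq_le:
  assumes "x \<in> {-1..1}"
  shows "(poly (legendre n) x)\<^sup>2 \<le> 2 * real n + 1"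
proof -
  let ?P = "legendre_poly n"
  let ?I = "\<integral>x. (poly ?P x)\<^sup>2 \<partial>unif_interval"
  have I: "?I > 0" by (rule legendre_poly_norm_pos)
  have "(poly ?P x)\<^sup>2 \<le> (poly ?P 1)\<^sup>2"
  proof (cases "n = 0")
    case True
    then show ?thesis by (simp add: legendre_poly_def)
  next
    case False
    then show ?thesis
      using legendre_poly_sq_le_endpoint[OF assms, of n] by (simp add: legendre_poly_sq_minus_one)
  qed
  then have "(poly ?P x)\<^sup>2 / ?I \<le> 2 * real n + 1"
    using I by (simp add: legendre_poly_sq_one pos_divide_le_eq)
  moreover have "(poly (legendre n) x)\<^sup>2 = (poly ?P x)\<^sup>2 / ?I"
    using I by (simp add: legendre_def power_mult_distrib power_divide)
  ultimately show ?thesis by simp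
qed

lemma multi_legendre_sq_le:
  fixes k :: "nat ^ 'd"
  assumes "\<xi> \<in> sym_cube"
  shows "(multi_legendre k \<xi>)\<^sup>2 \<le> exp (2 * real (\<Sum>i\<in>UNIV. k $ i))"
proof -
  have "(multi_legendre k \<xi>)\<^sup>2 = (\<Prod>i\<in>UNIV. (poly (legendre (k $ i)) (\<xi> $ i))\<^sup>2)"
    by (simp add: multi_legendre_def prod_power_distrib)
  also have "\<dots> \<le> (\<Prod>i\<in>UNIV. exp (2 * real (k $ i)))"
  proof (intro prod_mono conjI)
    fix i :: 'd
    have "(poly (legendre (k $ i)) (\<xi> $ i))\<^sup>2 \<le> 2 * real (k $ i) + 1"
      using assms by (intro legendre_sq_le) auto
    also have "\<dots> \<le> exp (2 * real (k $ i))"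
      by (subst add.commute) (rule exp_ge_add_one_self)
    finally show "(poly (legendre (k $ i)) (\<xi> $ i))\<^sup>2 \<le> exp (2 * real (k $ i))" .
  qed simp
  also have "\<dots> = exp (2 * real (\<Sum>i\<in>UNIV. k $ i))"
    by (simp add: exp_sum [symmetric] sum_distrib_left)
  finally show ?thesis .
qed

theorem theorem4p2:
  fixes M :: "'a measure" and \<Xi> :: "'a \<Rightarrow> real ^ 'd" and w :: "real ^ 'd \<Rightarrow> real"
    and p :: nat
  assumes "p \<ge> 1"
    and "standard_sampling M \<Xi> w"
  shows "coherence p w \<le> ereal (exp (2 * real p))"
proof -
  have "\<bar>w \<xi> * multi_legendre k \<xi>\<bar>\<^sup>2 \<le> exp (2 * real p)"
    if k: "k \<in> total_order p" and \<xi>: "\<xi> \<in> sym_cube" for k :: "nat ^ 'd" and \<xi>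
  proof -
    have "\<bar>w \<xi> * multi_legendre k \<xi>\<bar>\<^sup>2 = (multi_legendre k \<xi>)\<^sup>2"
      using assms(2) \<xi> by (simp add: standard_sampling_def)
    also have "\<dots> \<le> exp (2 * real (\<Sum>i\<in>UNIV. k $ i))"
      using \<xi> by (rule multi_legendre_sq_le)
    also have "\<dots> \<le> exp (2 * real p)"
      using k by (simp add: total_order_def del: of_nat_sum)
    finally show ?thesis .
  qed
  then show ?thesis
    unfolding coherence_def by (intro SUP_least) auto
qed

end
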